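(* Let $\overleftarrow{G}=\lim_{\leftarrow n}(G/\Gamma_n,\pi_n)$ be a subodometer. The set of eigenvalues of $\overleftarrow{G}$ is $$E_G=\bigcup_{n\ge0}\{\chi:G\to\mathbb{S}^1 \text{ character}:\ \chi(\gamma)=1\text{ for all }\gamma\in\Gamma_n\}.$$ Moreover, every eigenvalue of $\overleftarrow{G}$ is a continuous eigenvalue.
   Context: $G$ is a discrete finitely generated group with neutral element $e$. Subodometers: let $\Gamma_0\supseteq\Gamma_1\supseteq\cdots$ be a decreasing sequence of finite-index subgroups of $G$ (it is not required that $\bigcap_i\Gamma_i=\{e\}$), $G/\Gamma_i=\{g\Gamma_i\}$ discrete, $\pi_i:G/\Gamma_{i+1}\to G/\Gamma_i$ induced by inclusion. The inverse limit $\overleftarrow{G}=\lim_{\leftarrow i}(G/\Gamma_i,\pi_i)$ with the product topology and the action of $G$ by left multiplication on each coordinate is a subodometer. It has a unique $G$-invariant Borel probability measure $\lambda$, and $\overleftarrow{G}$ is regarded as a measure-theoretic system with $\lambda$. A character is a group homomorphism $\chi:G\to\mathbb{S}^1$, where $\mathbb{S}^1$ is the group of complex numbers of modulus 1. For a measure-theoretic system $(X,\mu,G)$, a character $\chi$ is an eigenvalue if there is $f\in L^2_\mu(X)\setminus\{0\}$ (an associated eigenfunction) with $f(g.x)=\chi(g)f(x)$ for all $x\in X$ (in the $L^2$ sense) and all $g\in G$. It is a continuous eigenvalue if it has an associated continuous eigenfunction. *)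

theory Defs
  imports "HOL-Analysis.Analysis" "HOL-Probability.Probability_Measure"
    "HOL-Algebra.Left_Coset" "HOL-Algebra.Generated_Groups"
begin

definition finitely_generated_group :: "('a, 'b) monoid_scheme \<Rightarrow> bool" where
  "finitely_generated_group G \<longleftrightarrow>
     group G \<and> (\<exists>S. finite S \<and> S \<subseteq> carrier G \<and> generate G S = carrier G)"

definition circle_group :: "complex monoid" where
  "circle_group = \<lparr>carrier = {z. cmod z = 1}, mult = (*), one = 1\<rparr>"

text \<open>As usual for \<^const>\<open>hom\<close>, the values of a character outside the carrier are irrelevant.\<close>

definition character :: "('a, 'b) monoid_scheme \<Rightarrow> ('a \<Rightarrow> complex) \<Rightarrow> bool" where
  "character G chi \<longleftrightarrow> chi \<in> hom G circle_group"


subsection \<open>Eigenvalues of measure-theoretic systems\<close>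

definition borel_measure_on :: "'x topology \<Rightarrow> 'x measure \<Rightarrow> bool" where
  "borel_measure_on X M \<longleftrightarrow>
     space M = topspace X \<and> sets M = sigma_sets (topspace X) {U. openin X U}"

definition invariant_measure ::
  "('a, 'b) monoid_scheme \<Rightarrow> ('a \<Rightarrow> 'x \<Rightarrow> 'x) \<Rightarrow> 'x measure \<Rightarrow> bool" where
  "invariant_measure G act M \<longleftrightarrow>
     (\<forall>g\<in>carrier G. act g \<in> measurable M M \<and> distr M M (act g) = M)"

text \<open>Elements of $L^2$ are represented by functions, so equalities between them hold
  almost everywhere; the null set may depend on \<open>g\<close>.\<close>

definition eigenfunction ::
  "('a, 'b) monoid_scheme \<Rightarrow> ('a \<Rightarrow> 'x \<Rightarrow> 'x) \<Rightarrow> 'x measure \<Rightarrow> ('a \<Rightarrow> complex) \<Rightarrow> ('x \<Rightarrow> complex) \<Rightarrow> bool"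
  where
  "eigenfunction G act M chi f \<longleftrightarrow>
     f \<in> borel_measurable M \<and> integrable M (\<lambda>x. (cmod (f x))\<^sup>2) \<and>
     \<not> (AE x in M. f x = 0) \<and>
     (\<forall>g\<in>carrier G. AE x in M. f (act g x) = chi g * f x)"

definition eigenvalue ::
  "('a, 'b) monoid_scheme \<Rightarrow> ('a \<Rightarrow> 'x \<Rightarrow> 'x) \<Rightarrow> 'x measure \<Rightarrow> ('a \<Rightarrow> complex) \<Rightarrow> bool" where
  "eigenvalue G act M chi \<longleftrightarrow> character G chi \<and> (\<exists>f. eigenfunction G act M chi f)"

definition continuous_eigenvalue ::
  "('a, 'b) monoid_scheme \<Rightarrow> ('a \<Rightarrow> 'x \<Rightarrow> 'x) \<Rightarrow> 'x topology \<Rightarrow> 'x measure \<Rightarrow> ('a \<Rightarrow> complex) \<Rightarrow> bool"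
  where
  "continuous_eigenvalue G act X M chi \<longleftrightarrow>
     character G chi \<and> (\<exists>f. continuous_map X euclidean f \<and> eigenfunction G act M chi f)"


subsection \<open>Subodometers\<close>

definition subodometer_sequence :: "('a, 'b) monoid_scheme \<Rightarrow> (nat \<Rightarrow> 'a set) \<Rightarrow> bool" where
  "subodometer_sequence G \<Gamma> \<longleftrightarrow>
     (\<forall>i. subgroup (\<Gamma> i) G \<and> finite (lcosets\<^bsub>G\<^esub> (\<Gamma> i)) \<and> \<Gamma> (Suc i) \<subseteq> \<Gamma> i)"

definition bonding_map :: "('a, 'b) monoid_scheme \<Rightarrow> (nat \<Rightarrow> 'a set) \<Rightarrow> nat \<Rightarrow> 'a set \<Rightarrow> 'a set" where
  "bonding_map G \<Gamma> i C = C <#>\<^bsub>G\<^esub> \<Gamma> i"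

text \<open>This is the map $g\Gamma_{i+1} \mapsto g\Gamma_i$.\<close>

lemma bonding_map_l_coset:
  assumes "group G" "subodometer_sequence G \<Gamma>" "g \<in> carrier G"
  shows "bonding_map G \<Gamma> i (g <#\<^bsub>G\<^esub> \<Gamma> (Suc i)) = g <#\<^bsub>G\<^esub> \<Gamma> i"
proof -
  interpret group G by fact
  have sub: "subgroup (\<Gamma> i) G" "subgroup (\<Gamma> (Suc i)) G" "\<Gamma> (Suc i) \<subseteq> \<Gamma> i"
    using assms(2) by (auto simp: subodometer_sequence_def)
  have "\<Gamma> (Suc i) <#>\<^bsub>G\<^esub> \<Gamma> i = \<Gamma> i"
  proof
    show "\<Gamma> (Suc i) <#>\<^bsub>G\<^esub> \<Gamma> i \<subseteq> \<Gamma> i"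
      using sub by (auto simp: set_mult_def intro: subgroup.m_closed)
    show "\<Gamma> i \<subseteq> \<Gamma> (Suc i) <#>\<^bsub>G\<^esub> \<Gamma> i"
    proof
      fix x assume "x \<in> \<Gamma> i"
      then have "x = \<one>\<^bsub>G\<^esub> \<otimes>\<^bsub>G\<^esub> x"
        using subgroup.mem_carrier[OF sub(1)] by simp
      with \<open>x \<in> \<Gamma> i\<close> show "x \<in> \<Gamma> (Suc i) <#>\<^bsub>G\<^esub> \<Gamma> i"
        using subgroup.one_closed[OF sub(2)] by (auto simp: set_mult_def)
    qed
  qed
  then show ?thesis
    using setmult_lcos_assoc[of "\<Gamma> (Suc i)" "\<Gamma> i" g] sub assms(3)
    by (simp add: bonding_map_def subgroup.subset)
qed

definition subodometer_space :: "('a, 'b) monoid_scheme \<Rightarrow> (nat \<Rightarrow> 'a set) \<Rightarrow> (nat \<Rightarrow> 'a set) set" where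
  "subodometer_space G \<Gamma> =
     {x. (\<forall>i. x i \<in> lcosets\<^bsub>G\<^esub> (\<Gamma> i)) \<and> (\<forall>i. bonding_map G \<Gamma> i (x (Suc i)) = x i)}"

definition subodometer_topology ::
  "('a, 'b) monoid_scheme \<Rightarrow> (nat \<Rightarrow> 'a set) \<Rightarrow> (nat \<Rightarrow> 'a set) topology" where
  "subodometer_topology G \<Gamma> =
     subtopology (product_topology (\<lambda>i. discrete_topology (lcosets\<^bsub>G\<^esub> (\<Gamma> i))) UNIV)
       (subodometer_space G \<Gamma>)"

definition subodometer_action ::
  "('a, 'b) monoid_scheme \<Rightarrow> 'a \<Rightarrow> (nat \<Rightarrow> 'a set) \<Rightarrow> (nat \<Rightarrow> 'a set)" where
  "subodometer_action G g x = (\<lambda>i. g <#\<^bsub>G\<^esub> x i)"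

text \<open>The invariant Borel probability measure of a subodometer exists and is unique, so this
  predicate holds of exactly one measure.\<close>

definition subodometer_measure ::
  "('a, 'b) monoid_scheme \<Rightarrow> (nat \<Rightarrow> 'a set) \<Rightarrow> (nat \<Rightarrow> 'a set) measure \<Rightarrow> bool" where
  "subodometer_measure G \<Gamma> M \<longleftrightarrow>
     borel_measure_on (subodometer_topology G \<Gamma>) M \<and> prob_space M \<and>
     invariant_measure G (subodometer_action G) M"

end

theory Submission
  imports Defs
begin

text \<open>
  Let \<open>f\<close> be an eigenfunction for \<open>chi\<close>. The cylinder over the coset \<open>g\<Gamma>\<^sub>n\<close> is invariant
  under \<open>g\<gamma>g\<^sup>-\<^sup>1\<close> for \<open>\<gamma> \<in> \<Gamma>\<^sub>n\<close>, and \<open>chi (g\<gamma>g\<^sup>-\<^sup>1) = chi \<gamma>\<close> because the circle is abelian. By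
  invariance of the measure, the integral of \<open>f\<close> over that cylinder equals \<open>chi \<gamma>\<close> times itself.
  If \<open>chi\<close> were trivial on no \<open>\<Gamma>\<^sub>n\<close>, all these integrals would vanish, and as the cylinders form
  an intersection-stable generator of the Borel sets, \<open>f\<close> would vanish almost everywhere.
  Conversely, a character that is trivial on \<open>\<Gamma>\<^sub>n\<close> factors through \<open>G/\<Gamma>\<^sub>n\<close>, and its composition
  with the \<open>n\<close>-th coordinate is a continuous eigenfunction.
\<close>

section \<open>Integrals over a generator and over invariant sets\<close>

text \<open>The sets over which \<open>f\<close> integrates to 0 form a Dynkin system, so by the
  pi-lambda argument they include all measurable sets, and then the density \<open>f\<close>
  vanishes. The assumption \<open>space\<close> provides closure under complements; it is stated
  separately because the whole space may lie outside \<open>\<E>\<close>.\<close>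

lemma (in sigma_finite_measure) AE_eq_0_if_set_integral_0_on_generator:
  fixes f :: "'a \<Rightarrow> 'b :: {second_countable_topology, banach}"
  assumes f: "integrable M f"
    and gen: "sets M = sigma_sets (space M) \<E>" "\<E> \<subseteq> Pow (space M)" "Int_stable \<E>"
    and zero: "\<And>A. A \<in> \<E> \<Longrightarrow> set_lebesgue_integral M A f = 0"
    and space: "integral\<^sup>L M f = 0"
  shows "AE x in M. f x = 0"
proof (rule density_zero[OF f])
  have int: "set_integrable M A f" if "A \<in> sets M" for A
    using f that by (simp add: set_integrable_def integrable_mult_indicator)
  have space': "set_lebesgue_integral M (space M) f = 0"
    using space by (simp add: set_integral_space[OF f])
  fix A assume "A \<in> sets M"
  then have "A \<in> sigma_sets (space M) \<E>"
    using gen(1) by simp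
  with gen(3,2) show "set_lebesgue_integral M A f = 0"
  proof (induction rule: sigma_sets_induct_disjoint)
    case (basic A)
    then show ?case by (rule zero)
  next
    case empty
    then show ?case by (simp add: set_lebesgue_integral_def)
  next
    case (compl A)
    then have A: "A \<in> sets M" using gen(1) by simp
    then have "set_lebesgue_integral M (A \<union> (space M - A)) f
        = set_lebesgue_integral M A f + set_lebesgue_integral M (space M - A) f"
      by (intro set_integral_Un int) auto
    moreover have "A \<union> (space M - A) = space M"
      using sets.sets_into_space[OF A] by blast
    ultimately show ?case
      using compl.IH space' by simp
  next
    case (union A)
    then have A: "A i \<in> sets M" for i using gen(1) by auto
    have "set_lebesgue_integral M (\<Union>i. A i) f = (\<Sum>i. set_lebesgue_integral M (A i) f)"
      using union.hyps(1) A
      by (intro lebesgue_integral_countable_add int) (auto simp: disjoint_family_on_def)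
    then show ?case using union.IH by simp
  qed
qed

text \<open>Substituting \<open>act g\<close> in the integral of \<open>f\<close> over the invariant
  set \<open>A\<close> gives an integral \<open>I\<close> with \<open>I = chi g * I\<close>, and
  \<open>I\<close> is nonzero.\<close>

lemma eigenvalue_eq_1_if_set_integral_nonzero:
  assumes inv: "invariant_measure G act M" and g: "g \<in> carrier G"
    and eig: "eigenfunction G act M chi f"
    and A: "A \<in> sets M" "\<And>x. x \<in> space M \<Longrightarrow> act g x \<in> A \<longleftrightarrow> x \<in> A"
    and nz: "set_lebesgue_integral M A f \<noteq> 0"
  shows "chi g = 1"
proof -
  have [measurable]: "act g \<in> measurable M M" "f \<in> borel_measurable M" "A \<in> sets M"
    using inv g eig A by (auto simp: invariant_measure_def eigenfunction_def)
  have distr: "distr M M (act g) = M"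
    using inv g by (auto simp: invariant_measure_def)
  have ae: "AE x in M. f (act g x) = chi g * f x"
    using eig g by (auto simp: eigenfunction_def)
  have "set_lebesgue_integral M A f = (\<integral>x. indicator A x *\<^sub>R f x \<partial>distr M M (act g))"
    by (simp add: set_lebesgue_integral_def distr)
  also have "\<dots> = (\<integral>x. indicator A (act g x) *\<^sub>R f (act g x) \<partial>M)"
    by (rule integral_distr) measurable
  also have "\<dots> = (\<integral>x. chi g * (indicator A x *\<^sub>R f x) \<partial>M)"
  proof (rule integral_cong_AE)
    show "AE x in M. indicator A (act g x) *\<^sub>R f (act g x) = chi g * (indicator A x *\<^sub>R f x)"
      using ae AE_space by eventually_elim (simp add: indicator_def A(2))
  qed measurable
  also have "\<dots> = chi g * set_lebesgue_integral M A f"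
    unfolding set_lebesgue_integral_def by (rule integral_mult_right_zero)
  finally show ?thesis
    using nz by simp
qed

section \<open>Characters\<close>

lemma character_mult:
  assumes "character G chi" "x \<in> carrier G" "y \<in> carrier G"
  shows "chi (x \<otimes>\<^bsub>G\<^esub> y) = chi x * chi y"
  using assms by (auto simp: character_def circle_group_def hom_def)

lemma norm_character:
  assumes "character G chi" "x \<in> carrier G"
  shows "cmod (chi x) = 1"
  using assms by (auto simp: character_def circle_group_def hom_def)

text \<open>The values of \<open>chi\<close> commute. Multiplying by \<open>chi g\<close> on the
  right avoids computing \<open>chi\<close> at an inverse; this factor can be cancelled since it has
  modulus one.\<close>

lemma character_conj:
  assumes "group G" "character G chi" "g \<in> carrier G" "x \<in> carrier G"
  shows "chi (g \<otimes>\<^bsub>G\<^esub> x \<otimes>\<^bsub>G\<^esub> inv\<^bsub>G\<^esub> g) = chi x"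
proof -
  interpret group G by fact
  have "chi (g \<otimes>\<^bsub>G\<^esub> x \<otimes>\<^bsub>G\<^esub> inv\<^bsub>G\<^esub> g) * chi g = chi (g \<otimes>\<^bsub>G\<^esub> x \<otimes>\<^bsub>G\<^esub> inv\<^bsub>G\<^esub> g \<otimes>\<^bsub>G\<^esub> g)"
    using assms by (simp add: character_mult)
  also have "\<dots> = chi x * chi g"
    using assms by (simp add: m_assoc character_mult)
  finally show ?thesis
    using norm_character[OF assms(2,3)] by auto
qed

section \<open>Coordinates, cylinders and Borel sets of a subodometer\<close>

locale subodometer = group G for G (structure) +
  fixes \<Gamma> :: "nat \<Rightarrow> 'a set"
  assumes seq: "subodometer_sequence G \<Gamma>"
begin

abbreviation "X \<equiv> subodometer_space G \<Gamma>"

abbreviation "T \<equiv> subodometer_topology G \<Gamma>"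

text \<open>If \<open>C\<close> is not a coset of \<open>\<Gamma> n\<close>, this is the empty
  set.\<close>

definition cylinder :: "nat \<Rightarrow> 'a set \<Rightarrow> (nat \<Rightarrow> 'a set) set" where
  "cylinder n C = {x \<in> X. x n = C}"

lemma subgroup_Gamma: "subgroup (\<Gamma> n) G"
  using seq by (auto simp: subodometer_sequence_def)

lemma coordinate_in_lcosets: "x \<in> X \<Longrightarrow> x n \<in> lcosets (\<Gamma> n)"
  by (auto simp: subodometer_space_def)

lemma coordinate_subset_carrier: "x \<in> X \<Longrightarrow> x n \<subseteq> carrier G"
  using coordinate_in_lcosets subgroup_Gamma subgroup.lcosets_carrier group_axioms by metis

lemma coordinate_nonempty: "x \<in> X \<Longrightarrow> x n \<noteq> {}"
  using coordinate_in_lcosets[of x n] lcos_self[OF _ subgroup_Gamma[of n]]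
  by (auto simp: LCOSETS_def)

text \<open>The bonding map sends \<open>x (Suc i)\<close> to its product with
  \<open>\<Gamma> i\<close>, which contains \<open>x (Suc i)\<close> because
  \<open>\<Gamma> i\<close> contains the neutral element. A point is thus a decreasing chain of
  cosets.\<close>

lemma coordinate_antimono:
  assumes "x \<in> X" "m \<le> n"
  shows "x n \<subseteq> x m"
  using assms(2)
proof (rule lift_Suc_antimono_le[rotated])
  fix i
  have "x (Suc i) \<subseteq> x (Suc i) <#> \<Gamma> i"
  proof
    fix y assume y: "y \<in> x (Suc i)"
    then have "y = y \<otimes> \<one>"
      using coordinate_subset_carrier[OF assms(1), of "Suc i"] by auto
    with y show "y \<in> x (Suc i) <#> \<Gamma> i"
      using subgroup.one_closed[OF subgroup_Gamma] unfolding set_mult_def by blast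
  qed
  then show "x (Suc i) \<subseteq> x i"
    using assms(1) by (auto simp: subodometer_space_def bonding_map_def)
qed

text \<open>Distinct cosets of \<open>\<Gamma> m\<close> are disjoint, but \<open>x m\<close> and
  \<open>y m\<close> both contain the nonempty set \<open>x n = y n\<close>.\<close>

lemma coordinate_determined:
  assumes "x \<in> X" "y \<in> X" "x n = y n" "m \<le> n"
  shows "x m = y m"
proof (rule ccontr)
  assume "x m \<noteq> y m"
  then have "x m \<inter> y m = {}"
    by (intro lcos_disjoint[OF subgroup_Gamma[of m]] coordinate_in_lcosets[of x] coordinate_in_lcosets[of y] assms)
  moreover have "x n \<subseteq> x m \<inter> y m"
    using assms coordinate_antimono by (metis Int_greatest)
  ultimately show False
    using coordinate_nonempty[OF assms(1)] by blast
qed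

lemma topspace_T: "topspace T = X"
  by (auto simp: subodometer_topology_def coordinate_in_lcosets)

lemma openin_cylinder: "openin T (cylinder n C)"
proof -
  have "continuous_map T (discrete_topology (lcosets (\<Gamma> n))) (\<lambda>x. x n)"
    unfolding subodometer_topology_def
    by (intro continuous_map_from_subtopology continuous_map_product_projection) simp
  \<comment> \<open>Intersecting with the set of cosets keeps the target set open in the discrete
    space also when \<open>C\<close> is not a coset.\<close>
  then have "openin T {x \<in> topspace T. x n \<in> lcosets (\<Gamma> n) \<inter> {C}}"
    by (rule openin_continuous_map_preimage) simp
  moreover have "{x \<in> topspace T. x n \<in> lcosets (\<Gamma> n) \<inter> {C}} = cylinder n C"
    using coordinate_in_lcosets by (auto simp: topspace_T cylinder_def)
  ultimately show ?thesis by simp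
qed

text \<open>A basic open set of the product restricts only finitely many coordinates. If
  \<open>n\<close> bounds their indices, coordinate \<open>n\<close> alone determines all of them,
  so the cylinders form a base.\<close>

lemma cylinder_in_open:
  assumes "openin T U" "x \<in> U"
  shows "\<exists>n. cylinder n (x n) \<subseteq> U"
proof -
  obtain S where S: "openin (product_topology (\<lambda>i. discrete_topology (lcosets (\<Gamma> i))) UNIV) S"
    and U: "U = S \<inter> X"
    using assms(1) by (auto simp: subodometer_topology_def openin_subtopology)
  have x: "x \<in> S" "x \<in> X" using assms(2) U by auto
  obtain V where fin: "finite {i. V i \<noteq> lcosets (\<Gamma> i)}" and xV: "x \<in> Pi\<^sub>E UNIV V"
    and VS: "Pi\<^sub>E UNIV V \<subseteq> S"
    using S x(1) unfolding openin_product_topology_alt by force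
  obtain n where n: "\<And>i. V i \<noteq> lcosets (\<Gamma> i) \<Longrightarrow> i \<le> n"
    using fin finite_nat_set_iff_bounded_le by auto
  have "cylinder n (x n) \<subseteq> U"
  proof
    fix y assume "y \<in> cylinder n (x n)"
    then have y: "y \<in> X" "y n = x n" by (auto simp: cylinder_def)
    have "y i \<in> V i" for i
    proof (cases "V i = lcosets (\<Gamma> i)")
      case True
      then show ?thesis using coordinate_in_lcosets y by simp
    next
      case False
      then have "y i = x i" using coordinate_determined[OF y(1) x(2) y(2)] n by blast
      then show ?thesis using xV by auto
    qed
    then show "y \<in> U" using VS U y by auto
  qed
  then show ?thesis ..
qed

text \<open>The empty set is included for stability under intersection. Indexing by cosets, finitely
  many at each level, shows that the family is countable.\<close>

definition cylinders :: "(nat \<Rightarrow> 'a set) set set" where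
  "cylinders = insert {} (\<Union>n. cylinder n ` (lcosets (\<Gamma> n)))"

lemma countable_cylinders: "countable cylinders"
  using seq by (auto simp: cylinders_def subodometer_sequence_def intro: countable_finite)

text \<open>Coordinate \<open>n\<close> determines coordinate \<open>m\<close>, so a cylinder of the
  finer level either lies inside one of the coarser level or misses it.\<close>

lemma cylinder_Int:
  assumes "m \<le> n"
  shows "cylinder m C \<inter> cylinder n D \<in> {{}, cylinder n D}"
proof (cases "cylinder m C \<inter> cylinder n D = {}")
  case False
  then obtain x where x: "x \<in> X" "x m = C" "x n = D"
    by (auto simp: cylinder_def)
  have "y m = C" if "y \<in> X" "y n = D" for y
    using coordinate_determined[of y x n m] that x assms by simp
  then show ?thesis
    by (auto simp: cylinder_def)
qed simp

lemma Int_stable_cylinders: "Int_stable cylinders"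
proof (rule Int_stableI)
  fix A B assume "A \<in> cylinders" "B \<in> cylinders"
  then consider "A \<inter> B = {}"
    | m n C D where "C \<in> lcosets (\<Gamma> m)" "D \<in> lcosets (\<Gamma> n)" "A = cylinder m C" "B = cylinder n D"
    by (auto simp: cylinders_def)
  then show "A \<inter> B \<in> cylinders"
  proof cases
    case 1
    then show ?thesis by (simp add: cylinders_def)
  next
    case 2
    then have "A \<inter> B \<in> {{}, A, B}"
      using cylinder_Int[of m n C D] cylinder_Int[of n m D C] by (metis Int_commute insert_iff nle_le)
    then show ?thesis
      using \<open>A \<in> cylinders\<close> \<open>B \<in> cylinders\<close> by (auto simp: cylinders_def)
  qed
qed

text \<open>An open set is the union of the cylinders that it contains, and there are only countably
  many cylinders.\<close>

lemma sigma_sets_open_eq_cylinders: "sigma_sets X {U. openin T U} = sigma_sets X cylinders"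
proof (rule sigma_sets_eqI)
  fix U assume U: "U \<in> {U. openin T U}"
  define \<A> where "\<A> = {A \<in> cylinders. A \<subseteq> U}"
  have "\<exists>A\<in>\<A>. x \<in> A" if x: "x \<in> U" for x
  proof -
    have "x \<in> X" using openin_subset[of T U] U x topspace_T by auto
    then have mem: "x \<in> cylinder n (x n)" "cylinder n (x n) \<in> cylinders" for n
      using coordinate_in_lcosets by (auto simp: cylinders_def cylinder_def)
    obtain n where "cylinder n (x n) \<subseteq> U"
      using cylinder_in_open[of U x] U x by auto
    then have "cylinder n (x n) \<in> \<A>"
      using mem(2) by (simp add: \<A>_def)
    then show ?thesis
      using mem(1) by blast
  qed
  then have "U = \<Union>\<A>" by (auto simp: \<A>_def)
  moreover have "countable \<A>"
    using countable_cylinders by (auto simp: \<A>_def intro: countable_subset)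
  ultimately show "U \<in> sigma_sets X cylinders"
    using sigma_sets_UNION[of \<A> X cylinders] by (simp add: \<A>_def sigma_sets.Basic)
next
  fix A assume "A \<in> cylinders"
  then have "openin T A"
    by (auto simp: cylinders_def openin_cylinder)
  then show "A \<in> sigma_sets X {U. openin T U}"
    by (simp add: sigma_sets.Basic)
qed

section \<open>Translation of cosets\<close>

lemma l_coset_lcosets:
  assumes "g \<in> carrier G" "h \<in> carrier G"
  shows "g <# (h <# \<Gamma> n) = (g \<otimes> h) <# \<Gamma> n"
  using assms subgroup.subset[OF subgroup_Gamma] by (simp add: lcos_m_assoc)

text \<open>The factor \<open>inv g\<close> cancels against \<open>g\<close>, and
  \<open>\<Gamma> n\<close> absorbs \<open>\<gamma>\<close>.\<close>

lemma conj_fixes_lcoset: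
  assumes "g \<in> carrier G" "\<gamma> \<in> \<Gamma> n"
  shows "(g \<otimes> \<gamma> \<otimes> inv g) <# (g <# \<Gamma> n) = g <# \<Gamma> n"
proof -
  have \<gamma>: "\<gamma> \<in> carrier G"
    using assms(2) subgroup.mem_carrier[OF subgroup_Gamma] by blast
  have "(g \<otimes> \<gamma> \<otimes> inv g) <# (g <# \<Gamma> n) = g <# (\<gamma> <# \<Gamma> n)"
    using assms(1) \<gamma> by (simp add: l_coset_lcosets m_assoc)
  also have "\<gamma> <# \<Gamma> n = \<Gamma> n"
    using coset_join3[OF \<gamma> subgroup_Gamma assms(2)] .
  finally show ?thesis .
qed

lemma l_coset_cancel:
  assumes "g \<in> carrier G" "A \<subseteq> carrier G" "B \<subseteq> carrier G" "g <# A = g <# B"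
  shows "A = B"
proof -
  have "inv g <# (g <# A) = inv g <# (g <# B)" using assms(4) by simp
  then show ?thesis using assms(1-3) by (simp add: lcos_m_assoc lcos_mult_one)
qed

end

section \<open>Eigenvalues of the measure-theoretic system\<close>

locale subodometer_system = subodometer +
  fixes M
  assumes measure: "subodometer_measure G \<Gamma> M"
begin

sublocale prob_space M
  using measure by (simp add: subodometer_measure_def)

lemma invariant: "invariant_measure G (subodometer_action G) M"
  using measure by (simp add: subodometer_measure_def)

lemma space_M: "space M = X"
  using measure by (simp add: subodometer_measure_def borel_measure_on_def topspace_T)

lemma sets_M: "sets M = sigma_sets X {U. openin T U}"
  using measure by (simp add: subodometer_measure_def borel_measure_on_def topspace_T)

lemma open_in_sets: "openin T U \<Longrightarrow> U \<in> sets M"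
  by (simp add: sets_M sigma_sets.Basic)

lemma borel_measurable_continuous:
  fixes f :: "_ \<Rightarrow> 'c :: topological_space"
  assumes "continuous_map T euclidean f"
  shows "f \<in> borel_measurable M"
proof (rule borel_measurableI)
  fix S :: "'c set" assume "open S"
  then have "openin T {x \<in> topspace T. f x \<in> S}"
    using openin_continuous_map_preimage[OF assms] by simp
  moreover have "{x \<in> topspace T. f x \<in> S} = f -` S \<inter> space M"
    by (auto simp: topspace_T space_M)
  ultimately show "f -` S \<inter> space M \<in> sets M"
    using open_in_sets by metis
qed

text \<open>This is read off from the measurability contained in \<open>invariant_measure\<close>: a
  measurable map sends \<open>space M\<close>, which is \<open>X\<close>, into itself.\<close>

lemma action_closed: "g \<in> carrier G \<Longrightarrow> x \<in> X \<Longrightarrow> subodometer_action G g x \<in> X"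
  using invariant measurable_space[of "subodometer_action G g" M M]
  by (auto simp: invariant_measure_def space_M)

lemma eigenvalue_trivial_on_Gamma:
  assumes "eigenvalue G (subodometer_action G) M chi"
  shows "\<exists>n. \<forall>\<gamma>\<in>\<Gamma> n. chi \<gamma> = 1"
proof (rule ccontr)
  assume "\<not> (\<exists>n. \<forall>\<gamma>\<in>\<Gamma> n. chi \<gamma> = 1)"
  then have nontriv: "\<exists>\<gamma>\<in>\<Gamma> n. chi \<gamma> \<noteq> 1" for n by blast
  obtain f where chi: "character G chi" and eig: "eigenfunction G (subodometer_action G) M chi f"
    using assms by (auto simp: eigenvalue_def)
  have [measurable]: "f \<in> borel_measurable M"
    and sq: "integrable M (\<lambda>x. (cmod (f x))\<^sup>2)" and nz: "\<not> (AE x in M. f x = 0)"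
    using eig by (auto simp: eigenfunction_def)
  \<comment> \<open>On a probability space a square integrable function is integrable, so the
    integrals of \<open>f\<close> over cylinders are meaningful.\<close>
  have "integrable M (\<lambda>x. cmod (f x))"
    by (rule square_integrable_imp_integrable[OF _ sq]) simp
  then have int: "integrable M f"
    by (simp add: integrable_norm_iff)
  have cyl: "set_lebesgue_integral M (cylinder n C) f = 0" if C: "C \<in> lcosets (\<Gamma> n)" for n C
  proof (rule ccontr)
    assume nonzero: "set_lebesgue_integral M (cylinder n C) f \<noteq> 0"
    obtain \<gamma> where \<gamma>: "\<gamma> \<in> \<Gamma> n" "chi \<gamma> \<noteq> 1" using nontriv by blast
    have \<gamma>G: "\<gamma> \<in> carrier G" using subgroup.mem_carrier[OF subgroup_Gamma] \<gamma>(1) by blast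
    obtain g where g: "g \<in> carrier G" and C_eq: "C = g <# \<Gamma> n"
      using C by (auto simp: LCOSETS_def)
    \<comment> \<open>As \<open>\<Gamma> n\<close> may fail to be normal, \<open>\<gamma>\<close>
      itself may move \<open>C\<close>. Its conjugate by the representative \<open>g\<close> fixes
      \<open>C\<close>, and \<open>chi\<close> takes the same value there.\<close>
    let ?k = "g \<otimes> \<gamma> \<otimes> inv g"
    have k: "?k \<in> carrier G" using g \<gamma>G by simp
    have fixed: "?k <# C = C"
      using conj_fixes_lcoset[OF g \<gamma>(1)] by (simp add: C_eq)
    have "subodometer_action G ?k x \<in> cylinder n C \<longleftrightarrow> x \<in> cylinder n C" if "x \<in> space M" for x
    proof -
      have x: "x \<in> X" using that space_M by simp
      \<comment> \<open>Since \<open>?k\<close> fixes \<open>C\<close>, the left side says that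
        \<open>?k\<close> sends \<open>x n\<close> and \<open>C\<close> to the same set, and
        translation is injective.\<close>
      have "?k <# x n = C \<longleftrightarrow> x n = C"
        using fixed l_coset_cancel[OF k coordinate_subset_carrier[OF x], of C n]
          subgroup.lcosets_carrier[OF subgroup_Gamma group_axioms C] by auto
      then show ?thesis
        using x action_closed[OF k x] by (simp add: cylinder_def subodometer_action_def)
    qed
    then have "chi ?k = 1"
      using eigenvalue_eq_1_if_set_integral_nonzero[OF invariant k eig open_in_sets[OF openin_cylinder]]
        nonzero by blast
    then show False
      using character_conj[OF group_axioms chi g \<gamma>G] \<gamma>(2) by simp
  qed
  \<comment> \<open>The whole space may fail to be a cylinder. It is invariant under every group
    element, so any \<open>\<gamma>\<close> with \<open>chi \<gamma> \<noteq> 1\<close> will do;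
    level 0 is an arbitrary choice.\<close>
  have "integral\<^sup>L M f = 0"
  proof (rule ccontr)
    assume "integral\<^sup>L M f \<noteq> 0"
    then have nonzero: "set_lebesgue_integral M (space M) f \<noteq> 0"
      by (simp add: set_integral_space[OF int])
    obtain \<gamma> where \<gamma>: "\<gamma> \<in> \<Gamma> 0" "chi \<gamma> \<noteq> 1" using nontriv by blast
    have \<gamma>G: "\<gamma> \<in> carrier G" using subgroup.mem_carrier[OF subgroup_Gamma] \<gamma>(1) by blast
    have "chi \<gamma> = 1"
      by (rule eigenvalue_eq_1_if_set_integral_nonzero[OF invariant \<gamma>G eig sets.top _ nonzero])
        (auto simp: space_M action_closed[OF \<gamma>G])
    with \<gamma>(2) show False ..
  qed
  moreover have "set_lebesgue_integral M A f = 0" if "A \<in> cylinders" for A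
    using that cyl by (auto simp: cylinders_def set_lebesgue_integral_def)
  moreover have "cylinders \<subseteq> Pow (space M)"
    by (auto simp: cylinders_def cylinder_def space_M)
  moreover have "sets M = sigma_sets (space M) cylinders"
    by (simp add: sets_M space_M sigma_sets_open_eq_cylinders)
  ultimately have "AE x in M. f x = 0"
    by (intro AE_eq_0_if_set_integral_0_on_generator[OF int _ _ Int_stable_cylinders])
  with nz show False ..
qed

lemma continuous_eigenvalue_if_trivial_on_Gamma:
  assumes chi: "character G chi" and triv: "\<And>\<gamma>. \<gamma> \<in> \<Gamma> n \<Longrightarrow> chi \<gamma> = 1"
  shows "continuous_eigenvalue G (subodometer_action G) T M chi"
proof -
  \<comment> \<open>The map induced by \<open>chi\<close> on cosets is evaluated at a chosen
    representative; \<open>chi_coset\<close> shows that the choice is immaterial.\<close>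
  define h where "h C = chi (SOME g. g \<in> C)" for C
  have chi_coset: "chi y = chi g" if g: "g \<in> carrier G" and y: "y \<in> g <# \<Gamma> n" for g y
  proof -
    obtain \<gamma> where "\<gamma> \<in> \<Gamma> n" "y = g \<otimes> \<gamma>" using y by (auto simp: l_coset_def)
    then show ?thesis
      using g triv subgroup.mem_carrier[OF subgroup_Gamma] by (simp add: character_mult[OF chi])
  qed
  have h: "h (g <# \<Gamma> n) = chi g" if "g \<in> carrier G" for g
    unfolding h_def by (rule chi_coset[OF that someI]) (rule lcos_self[OF that subgroup_Gamma])
  define f where "f x = h (x n)" for x :: "nat \<Rightarrow> 'a set"
  have cont: "continuous_map T euclidean f"
  proof -
    have "continuous_map T (discrete_topology (lcosets (\<Gamma> n))) (\<lambda>x. x n)"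
      unfolding subodometer_topology_def
      by (intro continuous_map_from_subtopology continuous_map_product_projection) simp
    \<comment> \<open>Every map out of a discrete space is continuous, so \<open>h\<close> preserves
      the continuity of the coordinate.\<close>
    then have "continuous_map T euclidean (h \<circ> (\<lambda>x. x n))"
      by (rule continuous_map_compose) simp
    then show ?thesis by (simp add: f_def[abs_def] o_def)
  qed
  have coset: "\<exists>k\<in>carrier G. x n = k <# \<Gamma> n" if "x \<in> space M" for x
    using coordinate_in_lcosets[of x n] that by (auto simp: LCOSETS_def space_M)
  \<comment> \<open>Constant modulus one yields both the square integrability of \<open>f\<close>
    and that it is not almost everywhere zero.\<close>
  have norm: "cmod (f x) = 1" if x: "x \<in> space M" for x
    using coset[OF x] h norm_character[OF chi] by (auto simp: f_def)
  have equi: "f (subodometer_action G g x) = chi g * f x"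
    if "g \<in> carrier G" "x \<in> space M" for g x
    using coset[OF that(2)] that(1) h
    by (auto simp: f_def subodometer_action_def l_coset_lcosets character_mult[OF chi])
  have "eigenfunction G (subodometer_action G) M chi f"
    unfolding eigenfunction_def
  proof (intro conjI ballI)
    show "f \<in> borel_measurable M" by (rule borel_measurable_continuous[OF cont])
    have "integrable M (\<lambda>x. 1 :: real)" by simp
    then show "integrable M (\<lambda>x. (cmod (f x))\<^sup>2)"
      by (subst Bochner_Integration.integrable_cong[OF refl]) (auto simp: norm)
    show "\<not> (AE x in M. f x = 0)"
    proof
      assume "AE x in M. f x = 0"
      then have "AE x in M. False"
        using AE_space by eventually_elim (use norm in force)
      then show False by simp
    qed
    show "AE x in M. f (subodometer_action G g x) = chi g * f x" if "g \<in> carrier G" for g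
      using equi that by simp
  qed
  then show ?thesis
    using chi cont by (auto simp: continuous_eigenvalue_def)
qed

end

theorem proposition3:
  fixes G :: "('a, 'b) monoid_scheme"
    and \<Gamma> :: "nat \<Rightarrow> 'a set"
    and lam :: "(nat \<Rightarrow> 'a set) measure"
  assumes "finitely_generated_group G"
    and "subodometer_sequence G \<Gamma>"
    and "subodometer_measure G \<Gamma> lam"
  shows "{chi. eigenvalue G (subodometer_action G) lam chi}
           = (\<Union>n. {chi. character G chi \<and> (\<forall>\<gamma>\<in>\<Gamma> n. chi \<gamma> = 1)})
         \<and> (\<forall>chi. eigenvalue G (subodometer_action G) lam chi
              \<longrightarrow> continuous_eigenvalue G (subodometer_action G) (subodometer_topology G \<Gamma>) lam chi)"
proof -
  interpret group G
    using assms(1) by (simp add: finitely_generated_group_def)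
  interpret subodometer_system G \<Gamma> lam
    by unfold_locales (fact assms)+
  let ?eig = "eigenvalue G (subodometer_action G) lam"
  let ?cont = "continuous_eigenvalue G (subodometer_action G) (subodometer_topology G \<Gamma>) lam"
  let ?triv = "\<lambda>chi. character G chi \<and> (\<exists>n. \<forall>\<gamma>\<in>\<Gamma> n. chi \<gamma> = 1)"
  \<comment> \<open>The three properties imply one another in a cycle, from \<open>?eig\<close> to
    \<open>?triv\<close> to \<open>?cont\<close> and back to \<open>?eig\<close>, which gives both
    halves of the claim.\<close>
  have triv: "?triv chi" if "?eig chi" for chi
    using that eigenvalue_trivial_on_Gamma[OF that] by (simp add: eigenvalue_def)
  have cont: "?cont chi" if triv: "?triv chi" for chi
  proof -
    obtain n where "\<forall>\<gamma>\<in>\<Gamma> n. chi \<gamma> = 1" using triv by (elim conjE exE)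
    then show ?thesis
      using triv by (intro continuous_eigenvalue_if_trivial_on_Gamma[of chi n]) simp_all
  qed
  have eig: "?eig chi" if "?cont chi" for chi
    using that by (auto simp: continuous_eigenvalue_def eigenvalue_def)
  have "?eig chi \<longleftrightarrow> ?triv chi" for chi
    by (rule iffI[OF triv eig[OF cont]])
  then have "{chi. ?eig chi} = (\<Union>n. {chi. character G chi \<and> (\<forall>\<gamma>\<in>\<Gamma> n. chi \<gamma> = 1)})"
    by simp blast
  moreover have "\<forall>chi. ?eig chi \<longrightarrow> ?cont chi"
    by (intro allI impI cont triv)
  ultimately show ?thesis ..
qed

end
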